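(* Let $B^H=(B^H_t)_{0\le t\le T}$ be a fractional Brownian motion with Hurst parameter $H\in(0,1)$, considered in its natural filtration. Let the target be $\xi_t=B^H_t$, $0\le t\le T$, and the initial position $x=0$. Then $$v(\kappa)\asymp\kappa^H,\qquad\kappa\downarrow0.$$ More explicitly, for $0<\kappa\le T^2/2$, $$\frac{\kappa^H}{12}\Big(T\,2^H-\frac{2H}{2H+1}\,2^{H+\frac12}\sqrt\kappa\Big)\le v(\kappa)\le T\,\Gamma(2H+1)\,\kappa^H .$$
   Context: Fix $T>0$; the filtration is the natural filtration of $B^H$, (augmented to satisfy the usual conditions). Let $\mathcal U$ be the set of progressively measurable processes $u=(u_t)_{0\le t\le T}$ with $\mathbb E\int_0^T u_t^2\,dt<\infty$, and for $u\in\mathcal U$ let $X^u_t=x+\int_0^t u_s\,ds$. For $\kappa\ge0$, $$J_\kappa(u)=\mathbb E\Big[\tfrac12\int_0^T(X^u_t-\xi_t)^2\,dt+\tfrac{\kappa}{2}\int_0^Tu_t^2\,dt\Big],\qquad v(\kappa)=\inf_{u\in\mathcal U}J_\kappa(u).$$ Fractional Brownian motion is the centered continuous Gaussian process with $B^H_0=0$ and $\mathbb E|B^H_t-B^H_s|^2=|t-s|^{2H}$. $\Gamma$ is the Gamma function. $f(\kappa)\asymp g(\kappa)$ as $\kappa\downarrow0$ means $f/g$ is bounded above and below by positive constants for all sufficiently small $\kappa>0$. *)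

theory Defs
  imports "HOL-Probability.Probability" "HOL-Library.Landau_Symbols"
begin

text \<open>Point masses count as (degenerate) Gaussian distributions.\<close>

definition gaussian_variable :: "'a measure \<Rightarrow> ('a \<Rightarrow> real) \<Rightarrow> bool" where
  "gaussian_variable M X \<longleftrightarrow>
     X \<in> borel_measurable M \<and>
     ((\<exists>\<mu> \<sigma>. \<sigma> > 0 \<and> distributed M lborel X (\<lambda>y. ennreal (normal_density \<mu> \<sigma> y))) \<or>
      (\<exists>\<mu>. AE \<omega> in M. X \<omega> = \<mu>))"

definition gaussian_process :: "'a measure \<Rightarrow> real set \<Rightarrow> (real \<Rightarrow> 'a \<Rightarrow> real) \<Rightarrow> bool" where
  "gaussian_process M I Y \<longleftrightarrow>
     (\<forall>S c. finite S \<and> S \<subseteq> I \<longrightarrow> gaussian_variable M (\<lambda>\<omega>. \<Sum>t\<in>S. c t * Y t \<omega>))"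

text \<open>Processes are indexed by all reals, but only their values on \<open>{0..T}\<close> matter.\<close>

definition fractional_brownian_motion ::
  "'a measure \<Rightarrow> real \<Rightarrow> real \<Rightarrow> (real \<Rightarrow> 'a \<Rightarrow> real) \<Rightarrow> bool" where
  "fractional_brownian_motion M T H B \<longleftrightarrow>
     gaussian_process M {0..T} B \<and>
     (\<forall>t\<in>{0..T}. (\<integral>\<omega>. B t \<omega> \<partial>M) = 0) \<and>
     (\<forall>\<omega>\<in>space M. continuous_on {0..T} (\<lambda>t. B t \<omega>)) \<and>
     (\<forall>\<omega>\<in>space M. B 0 \<omega> = 0) \<and>
     (\<forall>s\<in>{0..T}. \<forall>t\<in>{0..T}. (\<integral>\<omega>. \<bar>B t \<omega> - B s \<omega>\<bar>\<^sup>2 \<partial>M) = \<bar>t - s\<bar> powr (2 * H))"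

text \<open>
  The natural filtration of \<open>Y\<close>, enlarged by all negligible sets. A negligible set need not be
  measurable for \<open>M\<close>, so these are the null sets of the completion of \<open>M\<close>; accordingly,
  expectations of processes adapted to the filtration are taken in the completion.
\<close>

definition completed_natural_filtration ::
  "'a measure \<Rightarrow> (real \<Rightarrow> 'a \<Rightarrow> real) \<Rightarrow> real \<Rightarrow> 'a measure" where
  "completed_natural_filtration M Y t =
     sigma (space M)
       ({Y s -` A \<inter> space M | s A. s \<in> {0..t} \<and> A \<in> sets borel} \<union> null_sets (completion M))"

text \<open>
  Right-continuous version on the time interval \<open>{0..T}\<close>. Truncating at \<open>T\<close> makes the
  \<open>\<sigma>\<close>-algebra at the terminal time that of the completed natural filtration.
\<close>

definition augmented_filtration ::
  "'a measure \<Rightarrow> real \<Rightarrow> (real \<Rightarrow> 'a \<Rightarrow> real) \<Rightarrow> real \<Rightarrow> 'a measure" where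
  "augmented_filtration M T Y t =
     sigma (space M) (\<Inter>s\<in>{t<..}. sets (completed_natural_filtration M Y (min s T)))"

definition progressively_measurable ::
  "real \<Rightarrow> (real \<Rightarrow> 'a measure) \<Rightarrow> (real \<Rightarrow> 'a \<Rightarrow> real) \<Rightarrow> bool" where
  "progressively_measurable T F u \<longleftrightarrow>
     (\<forall>t\<in>{0..T}. (\<lambda>(s, \<omega>). u s \<omega>)
        \<in> borel_measurable (restrict_space borel {0..t} \<Otimes>\<^sub>M F t))"

definition admissible_controls ::
  "'a measure \<Rightarrow> real \<Rightarrow> (real \<Rightarrow> 'a measure) \<Rightarrow> (real \<Rightarrow> 'a \<Rightarrow> real) set" where
  "admissible_controls M T F =
     {u. progressively_measurable T F u \<and>
         (\<integral>\<^sup>+\<omega>. (\<integral>\<^sup>+t\<in>{0..T}. ennreal ((u t \<omega>)\<^sup>2) \<partial>lborel) \<partial>completion M) < \<infinity>}"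

definition controlled_state ::
  "real \<Rightarrow> (real \<Rightarrow> 'a \<Rightarrow> real) \<Rightarrow> real \<Rightarrow> 'a \<Rightarrow> real" where
  "controlled_state x u t \<omega> = x + (LINT s:{0..t}|lborel. u s \<omega>)"

text \<open>
  The cost has a nonnegative integrand, so it is taken as an extended nonnegative integral:
  no value is assigned by convention to a divergent expectation.
\<close>

definition tracking_cost ::
  "'a measure \<Rightarrow> real \<Rightarrow> (real \<Rightarrow> 'a \<Rightarrow> real) \<Rightarrow> real \<Rightarrow> real \<Rightarrow> (real \<Rightarrow> 'a \<Rightarrow> real) \<Rightarrow> ennreal" where
  "tracking_cost M T \<xi> x \<kappa> u =
     (\<integral>\<^sup>+\<omega>. ennreal (1 / 2) *
               (\<integral>\<^sup>+t\<in>{0..T}. ennreal ((controlled_state x u t \<omega> - \<xi> t \<omega>)\<^sup>2) \<partial>lborel)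
           + ennreal (\<kappa> / 2) * (\<integral>\<^sup>+t\<in>{0..T}. ennreal ((u t \<omega>)\<^sup>2) \<partial>lborel)
        \<partial>completion M)"

definition tracking_value ::
  "'a measure \<Rightarrow> real \<Rightarrow> (real \<Rightarrow> 'a measure) \<Rightarrow> (real \<Rightarrow> 'a \<Rightarrow> real) \<Rightarrow> real \<Rightarrow> real \<Rightarrow> ennreal" where
  "tracking_value M T F \<xi> x \<kappa> = (INF u\<in>admissible_controls M T F. tracking_cost M T \<xi> x \<kappa> u)"

end

(* Lower bound, path by path: with delta = sqrt (2 kappa), the increment of B over the lag delta is
   the sum of two tracking errors and an increment of X. The latter is controlled by the energy of u
   through Cauchy-Schwarz, so the squared increment, integrated over time, is at most 12 times the
   cost; its expectation is the integral of min(t, delta)^(2H).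

   Upper bound: with epsilon = sqrt kappa, take u = (B - X) / epsilon, so that both terms of the cost
   are equal and X is the exponential moving average of B. Then B - X is the mean of the increments
   of B over an exponentially distributed lag of mean epsilon, and Jensen's inequality bounds
   E (B - X)^2 by the moment of order 2H of this lag, Gamma(2H + 1) epsilon^(2H). *)

theory Submission imports Defs begin

text \<open>A path by path estimate holds for every lag \<delta>, with weight 6 on the squared
  tracking error and 3 \<delta>^2 on the energy of u. These weights stand in the ratio 1 : \<kappa>
  of the cost exactly when \<delta>^2 = 2 \<kappa>, and the factor 12 is then 6 / (1/2). The
  restriction \<kappa> \<le> T^2 / 2 says that this lag fits into the horizon. The rate 1 / sqrt
  \<kappa> of the upper bound is the gain of the stationary Riccati equation for this quadratic
  cost. Since the moving average at time t involves B only up to t, the feedback is adapted. The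
  start needs care: an increment over the lag r begins at max 0 (t - r). As X and B both vanish at
  time 0, continuing them by 0 to negative times produces no boundary term in either bound. The
  exchanges of expectation, time integral and mean over the lag rest on joint measurability, which
  is obtained from the continuity of the paths.\<close>

section \<open>Joint measurability of continuous processes\<close>

lemma floor_scale_tendsto:
  fixes s :: real
  shows "(\<lambda>n. of_int \<lfloor>real (Suc n) * s\<rfloor> / real (Suc n)) \<longlonglongrightarrow> s"
proof (rule tendsto_sandwich)
  have "(\<lambda>n. s - inverse (real (Suc n))) \<longlonglongrightarrow> s - 0"
    by (intro tendsto_diff tendsto_const LIMSEQ_inverse_real_of_nat)
  then show "(\<lambda>n. s - inverse (real (Suc n))) \<longlonglongrightarrow> s"
    by simp
  show "\<forall>\<^sub>F n in sequentially. s - inverse (real (Suc n)) \<le> of_int \<lfloor>real (Suc n) * s\<rfloor> / real (Suc n)"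
  proof (intro always_eventually allI)
    fix n
    have "real (Suc n) * s - 1 \<le> of_int \<lfloor>real (Suc n) * s\<rfloor>"
      by linarith
    then have "(real (Suc n) * s - 1) / real (Suc n) \<le> of_int \<lfloor>real (Suc n) * s\<rfloor> / real (Suc n)"
      by (intro divide_right_mono) auto
    then show "s - inverse (real (Suc n)) \<le> of_int \<lfloor>real (Suc n) * s\<rfloor> / real (Suc n)"
      by (simp add: diff_divide_distrib inverse_eq_divide)
  qed
  show "\<forall>\<^sub>F n in sequentially. of_int \<lfloor>real (Suc n) * s\<rfloor> / real (Suc n) \<le> s"
  proof (intro always_eventually allI)
    fix n
    have "of_int \<lfloor>real (Suc n) * s\<rfloor> / real (Suc n) \<le> (real (Suc n) * s) / real (Suc n)"
      by (intro divide_right_mono) auto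
    then show "of_int \<lfloor>real (Suc n) * s\<rfloor> / real (Suc n) \<le> s"
      by simp
  qed
qed (rule tendsto_const)

text \<open>Sampled on a grid of mesh \<open>1 / Suc n\<close>, the process uses only countably many
  times and is jointly measurable; by continuity the samples converge. Clamping is applied after
  rounding, so no time outside \<open>{a..b}\<close> is ever sampled. With \<open>N\<close> the
  sigma-algebra at time \<open>b\<close>, this is what respects adaptedness.\<close>

lemma borel_measurable_clamped_process:
  fixes Y :: "real \<Rightarrow> 'a \<Rightarrow> real"
  assumes meas: "\<And>s. s \<in> {a..b} \<Longrightarrow> Y s \<in> borel_measurable N"
    and cont: "\<And>\<omega>. \<omega> \<in> space N \<Longrightarrow> continuous_on {a..b} (\<lambda>s. Y s \<omega>)"
    and ab: "a \<le> b"
  shows "(\<lambda>p. Y (max a (min b (fst p))) (snd p)) \<in> borel_measurable (borel \<Otimes>\<^sub>M N)"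
proof (rule borel_measurable_LIMSEQ_real)
  define c where "c s = max a (min b s)" for s
  have c: "c s \<in> {a..b}" for s
    using ab by (auto simp: c_def)
  let ?f = "\<lambda>n p. Y (c (of_int \<lfloor>real (Suc n) * fst p\<rfloor> / real (Suc n))) (snd p)"
  show "?f n \<in> borel_measurable (borel \<Otimes>\<^sub>M N)" for n
  proof (rule measurable_compose_countable[where
      f = "\<lambda>i p. Y (c (of_int i / real (Suc n))) (snd p)"
      and g = "\<lambda>p. \<lfloor>real (Suc n) * fst p\<rfloor>"])
    show "(\<lambda>p. Y (c (of_int i / real (Suc n))) (snd p)) \<in> borel_measurable (borel \<Otimes>\<^sub>M N)" for i
      by (rule measurable_compose[OF measurable_snd meas[OF c]])
    show "(\<lambda>p. \<lfloor>real (Suc n) * fst p\<rfloor>) \<in> borel \<Otimes>\<^sub>M N \<rightarrow>\<^sub>M count_space UNIV"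
      by measurable
  qed
  fix p assume p: "p \<in> space (borel \<Otimes>\<^sub>M N :: (real \<times> 'a) measure)"
  then have \<omega>: "snd p \<in> space N"
    by (auto simp: space_pair_measure)
  have "(\<lambda>n. c (of_int \<lfloor>real (Suc n) * fst p\<rfloor> / real (Suc n))) \<longlonglongrightarrow> c (fst p)"
    unfolding c_def by (intro tendsto_max tendsto_min tendsto_const floor_scale_tendsto)
  then show "(\<lambda>n. ?f n p) \<longlonglongrightarrow> Y (max a (min b (fst p))) (snd p)"
    unfolding c_def[symmetric]
    by (rule continuous_on_tendsto_compose[OF cont[OF \<omega>]]) (use c in auto)
qed

lemma borel_measurable_clamped_process_compose:
  fixes Y :: "real \<Rightarrow> 'a \<Rightarrow> real"
  assumes "\<And>s. s \<in> {a..b} \<Longrightarrow> Y s \<in> borel_measurable N"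
    and "\<And>\<omega>. \<omega> \<in> space N \<Longrightarrow> continuous_on {a..b} (\<lambda>s. Y s \<omega>)"
    and "a \<le> b"
    and g: "g \<in> borel_measurable K" and h: "h \<in> K \<rightarrow>\<^sub>M N"
  shows "(\<lambda>x. Y (max a (min b (g x))) (h x)) \<in> borel_measurable K"
  using measurable_compose[OF measurable_Pair[OF g h] borel_measurable_clamped_process[OF assms(1-3)]]
  by simp

text \<open>For \<open>a = 0\<close>, \<open>b = t\<close> and \<open>N\<close> the sigma-algebra at
  time \<open>t\<close>, this is the classical fact that continuous adapted processes are
  progressively measurable. Clamping is the identity on \<open>{a..b}\<close>.\<close>

lemma borel_measurable_continuous_process:
  fixes Y :: "real \<Rightarrow> 'a \<Rightarrow> real"
  assumes "\<And>s. s \<in> {a..b} \<Longrightarrow> Y s \<in> borel_measurable N"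
    and "\<And>\<omega>. \<omega> \<in> space N \<Longrightarrow> continuous_on {a..b} (\<lambda>s. Y s \<omega>)"
    and "a \<le> b"
  shows "(\<lambda>(s, \<omega>). Y s \<omega>) \<in> borel_measurable (restrict_space borel {a..b} \<Otimes>\<^sub>M N)"
proof -
  have "(\<lambda>p. (fst p, snd p)) \<in> restrict_space borel {a..b} \<Otimes>\<^sub>M N \<rightarrow>\<^sub>M (borel :: real measure) \<Otimes>\<^sub>M N"
    by (intro measurable_Pair measurable_snd
        measurable_compose[OF measurable_fst] measurable_restrict_space1 measurable_ident_sets[OF refl])
  from measurable_compose[OF this borel_measurable_clamped_process[OF assms]]
  show ?thesis
    by (rule measurable_cong[THEN iffD1, rotated])
      (auto simp: space_pair_measure space_restrict_space)
qed

section \<open>Integral inequalities and the moments of the exponential law\<close>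

text \<open>Cauchy-Schwarz against the constant 1; on a probability space, Jensen's inequality for
  the square. If \<open>f\<close> is not integrable, its Bochner integral is 0 by convention and the
  bound is trivial.\<close>

lemma (in finite_measure) integral_squared_le:
  fixes f :: "'a \<Rightarrow> real"
  assumes [measurable]: "f \<in> borel_measurable M"
  shows "ennreal ((\<integral>x. f x \<partial>M)\<^sup>2) \<le> emeasure M (space M) * (\<integral>\<^sup>+x. ennreal ((f x)\<^sup>2) \<partial>M)"
proof (cases "integrable M f")
  case False
  then show ?thesis by (simp add: not_integrable_integral_eq)
next
  case True
  have "ennreal \<bar>\<integral>x. f x \<partial>M\<bar> \<le> (\<integral>\<^sup>+x. ennreal \<bar>f x\<bar> \<partial>M)"
    using integral_norm_bound_ennreal[OF True] by simp
  then have "(ennreal \<bar>\<integral>x. f x \<partial>M\<bar>)\<^sup>2 \<le> (\<integral>\<^sup>+x. ennreal \<bar>f x\<bar> * 1 \<partial>M)\<^sup>2"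
    by (simp add: power_mono)
  also have "\<dots> \<le> (\<integral>\<^sup>+x. (ennreal \<bar>f x\<bar>)\<^sup>2 \<partial>M) * (\<integral>\<^sup>+x. 1\<^sup>2 \<partial>M)"
    by (rule Cauchy_Schwarz_nn_integral) auto
  finally show ?thesis
    by (simp add: ennreal_power mult.commute)
qed

text \<open>Scaling \<open>r\<close> by \<open>\<epsilon>\<close> turns the integrand into that of
  the Gamma function at \<open>p + 1\<close>.\<close>

lemma exponential_moment:
  assumes \<epsilon>: "\<epsilon> > 0" and p: "p > 0"
  shows "(\<integral>\<^sup>+r. ennreal (exponential_density (1 / \<epsilon>) r) * ennreal (r powr p) \<partial>lborel)
    = ennreal (Gamma (p + 1) * \<epsilon> powr p)"
proof -
  have "(\<integral>\<^sup>+r. ennreal (exponential_density (1 / \<epsilon>) r) * ennreal (r powr p) \<partial>lborel)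
    = ennreal \<epsilon> * (\<integral>\<^sup>+r. ennreal (exponential_density (1 / \<epsilon>) (0 + \<epsilon> * r)) * ennreal ((0 + \<epsilon> * r) powr p) \<partial>lborel)"
    using \<epsilon> by (subst nn_integral_real_affine[where c=\<epsilon> and t=0]) (auto simp: exponential_density_def)
  also have "\<dots> = (\<integral>\<^sup>+r. ennreal (\<epsilon> powr p) * ennreal (indicator {0..} r * r powr (p + 1 - 1) / exp r) \<partial>lborel)"
    using \<epsilon> p
    by (subst nn_integral_cmult[symmetric])
      (auto intro!: nn_integral_cong simp: exponential_density_def indicator_def powr_mult
        exp_minus field_simps ennreal_mult'[symmetric] mult_less_0_iff zero_less_mult_iff)
  also have "\<dots> = ennreal (\<epsilon> powr p) * ennreal (Gamma (p + 1))"
    using p by (subst Gamma_conv_nn_integral_real) (auto simp: nn_integral_cmult)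
  finally show ?thesis
    using p by (simp add: ennreal_mult'[symmetric] mult.commute)
qed

lemma square_sum3_le:
  fixes a b c :: real
  shows "(a + b + c)\<^sup>2 \<le> 3 * a\<^sup>2 + 3 * b\<^sup>2 + 3 * c\<^sup>2"
proof -
  have "3 * a\<^sup>2 + 3 * b\<^sup>2 + 3 * c\<^sup>2 - (a + b + c)\<^sup>2 = (a - b)\<^sup>2 + (b - c)\<^sup>2 + (a - c)\<^sup>2"
    by (simp add: power2_eq_square algebra_simps)
  then show ?thesis
    using zero_le_power2[of "a - b"] zero_le_power2[of "b - c"] zero_le_power2[of "a - c"] by linarith
qed

lemma set_integral_squared_le:
  fixes f :: "real \<Rightarrow> real"
  assumes [measurable]: "f \<in> borel_measurable borel" and ab: "a \<le> b"
  shows "ennreal ((LINT s:{a<..b}|lborel. f s)\<^sup>2) \<le> ennreal (b - a) * (\<integral>\<^sup>+s\<in>{a<..b}. ennreal ((f s)\<^sup>2) \<partial>lborel)"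
proof -
  interpret finite_measure "restrict_space lborel {a<..b}"
    by (rule finite_measureI) (use ab in \<open>simp add: space_restrict_space emeasure_restrict_space\<close>)
  have "f \<in> borel_measurable (restrict_space lborel {a<..b})"
    by (intro measurable_restrict_space1) simp
  from integral_squared_le[OF this] show ?thesis
    using ab by (simp add: integral_restrict_space nn_integral_restrict_space space_restrict_space
        emeasure_restrict_space set_lebesgue_integral_def)
qed

text \<open>Tonelli: a point \<open>s\<close> belongs to the window \<open>{t - \<delta>..t}\<close>
  precisely for \<open>t\<close> in \<open>{s..s + \<delta>}\<close>, a set of length
  \<open>\<delta>\<close>.\<close>

lemma nn_integral_moving_window:
  fixes h :: "real \<Rightarrow> ennreal"
  assumes [measurable]: "h \<in> borel_measurable borel" and \<delta>: "\<delta> \<ge> 0"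
  shows "(\<integral>\<^sup>+t. (\<integral>\<^sup>+s\<in>{t - \<delta>..t}. h s \<partial>lborel) \<partial>lborel) = ennreal \<delta> * (\<integral>\<^sup>+s. h s \<partial>lborel)"
proof -
  have "(\<integral>\<^sup>+t. (\<integral>\<^sup>+s\<in>{t - \<delta>..t}. h s \<partial>lborel) \<partial>lborel)
      = (\<integral>\<^sup>+t. (\<integral>\<^sup>+s. (if t - \<delta> \<le> s \<and> s \<le> t then h s else 0) \<partial>lborel) \<partial>lborel)"
    by (intro nn_integral_cong) (auto simp: indicator_def)
  also have "\<dots> = (\<integral>\<^sup>+s. (\<integral>\<^sup>+t. (if t - \<delta> \<le> s \<and> s \<le> t then h s else 0) \<partial>lborel) \<partial>lborel)"
    by (rule lborel_pair.Fubini') measurable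
  also have "\<dots> = (\<integral>\<^sup>+s. (\<integral>\<^sup>+t. h s * indicator {s..s + \<delta>} t \<partial>lborel) \<partial>lborel)"
    by (intro nn_integral_cong) (auto simp: indicator_def)
  also have "\<dots> = (\<integral>\<^sup>+s. h s * ennreal \<delta> \<partial>lborel)"
    using \<delta> by (simp add: nn_integral_cmult_indicator)
  finally show ?thesis
    by (simp add: nn_integral_multc mult.commute[of _ "ennreal \<delta>"] nn_integral_cmult)
qed

section \<open>The lower estimate along a path\<close>

text \<open>Finite energy on a bounded interval makes the control integrable. This guarantees that
  the Bochner integral defining the state is additive in time and not a default value 0.\<close>

lemma set_integrable_of_square:
  fixes u :: "real \<Rightarrow> real"
  assumes u: "u \<in> borel_measurable (restrict_space borel {0..T})"
    and fin: "(\<integral>\<^sup>+t\<in>{0..T}. ennreal ((u t)\<^sup>2) \<partial>lborel) < \<infinity>"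
  shows "set_integrable lborel {0..T} u"
proof -
  interpret finite_measure "restrict_space lborel {0..T}"
    by (rule finite_measureI) (simp add: space_restrict_space emeasure_restrict_space emeasure_lborel_Icc_eq)
  have [measurable]: "u \<in> borel_measurable (restrict_space lborel {0..T})"
    using u measurable_cong_sets[OF sets_restrict_space_cong[OF sets_lborel] refl] by blast
  have "integrable (restrict_space lborel {0..T}) (\<lambda>t. (u t)\<^sup>2)"
  proof (rule integrableI_bounded)
    show "(\<integral>\<^sup>+t. ennreal (norm ((u t)\<^sup>2)) \<partial>restrict_space lborel {0..T}) < \<infinity>"
      using fin by (simp add: nn_integral_restrict_space)
  qed measurable
  then have "integrable (restrict_space lborel {0..T}) u"
    by (rule square_integrable_imp_integrable[rotated]) measurable
  then show ?thesis
    by (simp add: integrable_restrict_space set_integrable_def)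
qed

text \<open>The factor 3 comes from squaring a sum of three terms. The tracking error occurs at both
  ends of the lag, which gives 6. The energy receives one factor \<open>\<delta>\<close> from
  Cauchy-Schwarz on an interval of length at most \<open>\<delta>\<close> and another from
  integrating over the moving window.\<close>

lemma tracking_path_lower_bound:
  fixes y u :: "real \<Rightarrow> real"
  assumes \<delta>: "\<delta> > 0"
    and y: "continuous_on {0..T} y" "y 0 = 0"
    and u: "u \<in> borel_measurable (restrict_space borel {0..T})"
  defines "X \<equiv> \<lambda>t. LINT s:{0..t}|lborel. u s"
  shows "(\<integral>\<^sup>+t\<in>{0..T}. ennreal ((y t - y (max 0 (t - \<delta>)))\<^sup>2) \<partial>lborel)
    \<le> 6 * (\<integral>\<^sup>+t\<in>{0..T}. ennreal ((X t - y t)\<^sup>2) \<partial>lborel)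
      + ennreal (3 * \<delta>\<^sup>2) * (\<integral>\<^sup>+t\<in>{0..T}. ennreal ((u t)\<^sup>2) \<partial>lborel)"
proof (cases "(\<integral>\<^sup>+t\<in>{0..T}. ennreal ((u t)\<^sup>2) \<partial>lborel) < \<infinity>")
  \<comment> \<open>Infinite energy makes the right-hand side infinite, because its coefficient is
    positive.\<close>
  case False
  then show ?thesis
    using \<delta> by (simp add: top.not_eq_extremum[symmetric] ennreal_mult_top)
next
  case True
  define g where "g s = (if s \<in> {0..T} then u s else 0)" for s
  have g_eq: "g = (\<lambda>s. indicator {0..T} s *\<^sub>R u s)"
    by (auto simp: g_def indicator_def)
  have [measurable]: "g \<in> borel_measurable borel"
    using u unfolding g_eq by (subst (asm) borel_measurable_restrict_space_iff) auto
  have int_g: "integrable lborel g"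
    using set_integrable_of_square[OF u True] unfolding g_eq set_integrable_def .
  \<comment> \<open>\<open>Z\<close> agrees with the state up to time \<open>T\<close>. The
    conditional integrand is jointly measurable in both times, which gives the measurability of
    \<open>Z\<close>.\<close>
  define Z where "Z t = (\<integral>s. (if 0 \<le> s \<and> s \<le> t then g s else 0) \<partial>lborel)" for t
  have [measurable]: "Z \<in> borel_measurable borel"
    unfolding Z_def by measurable
  have XZ: "X t = Z t" if "t \<le> T" for t
    unfolding X_def Z_def set_lebesgue_integral_def
    by (intro Bochner_Integration.integral_cong) (use that in \<open>auto simp: g_def indicator_def\<close>)
  have Z_diff: "Z t - Z s = (LINT r:{s<..t}|lborel. g r)" if "0 \<le> s" "s \<le> t" for s t
  proof -
    have i: "integrable lborel (\<lambda>r. if 0 \<le> r \<and> r \<le> t then g r else 0)" for t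
      by (rule Bochner_Integration.integrable_bound[OF int_g]) auto
    show ?thesis
      unfolding Z_def set_lebesgue_integral_def
      by (subst Bochner_Integration.integral_diff[symmetric])
        (use that in \<open>auto intro!: i Bochner_Integration.integral_cong simp: indicator_def\<close>)
  qed
  have "Z 0 = (\<integral>s. indicator {0} s *\<^sub>R g s \<partial>lborel)"
    unfolding Z_def by (intro Bochner_Integration.integral_cong) (auto simp: indicator_def)
  also have "\<dots> = 0"
    by (intro integral_eq_zero_AE AE_I[where N="{0}"]) (auto simp: indicator_def)
  finally have Z0: "Z 0 = 0" .
  \<comment> \<open>Extended by 0 outside \<open>{0..T}\<close>, the error at the earlier time
    \<open>t - \<delta>\<close> can be integrated over the whole line, where a translation does not
    change the integral.\<close>
  define A where "A t = (if t \<in> {0..T} then ennreal ((Z t - y (max 0 (min T t)))\<^sup>2) else 0)" for t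
  have [measurable]: "(\<lambda>t. y (max 0 (min T t))) \<in> borel_measurable borel" if "0 \<le> T"
    by (intro borel_measurable_continuous_onI continuous_on_compose2[OF y(1)] continuous_intros)
      (use that in auto)
  have [measurable]: "A \<in> borel_measurable borel"
  proof (cases "0 \<le> T")
    case True
    then show ?thesis unfolding A_def by measurable
  next
    case False
    then have "A = (\<lambda>_. 0)" by (auto simp: A_def)
    then show ?thesis by simp
  qed
  define V where "V t = (\<integral>\<^sup>+s\<in>{t - \<delta>..t}. ennreal ((g s)\<^sup>2) \<partial>lborel)" for t
  have "V = (\<lambda>t. \<integral>\<^sup>+s. (if t - \<delta> \<le> s \<and> s \<le> t then ennreal ((g s)\<^sup>2) else 0) \<partial>lborel)"
    unfolding V_def by (intro ext nn_integral_cong) (auto simp: indicator_def)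
  then have [measurable]: "V \<in> borel_measurable borel"
    by simp
  have "ennreal ((y t - y (max 0 (t - \<delta>)))\<^sup>2) * indicator {0..T} t
      \<le> 3 * A t + ennreal (3 * \<delta>) * V t + 3 * A (t - \<delta>)" for t
  proof (cases "t \<in> {0..T}")
    case False
    then show ?thesis by simp
  next
    case t: True
    define s where "s = max 0 (t - \<delta>)"
    have s: "0 \<le> s" "s \<le> t" "t - s \<le> \<delta>" "t - \<delta> \<le> s"
      using t \<delta> by (auto simp: s_def)
    have "(y t - y s)\<^sup>2 = ((y t - Z t) + (Z t - Z s) + (Z s - y s))\<^sup>2"
      by simp
    also have "\<dots> \<le> 3 * (y t - Z t)\<^sup>2 + 3 * (Z t - Z s)\<^sup>2 + 3 * (Z s - y s)\<^sup>2"
      by (rule square_sum3_le)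
    finally have "ennreal ((y t - y s)\<^sup>2)
        \<le> ennreal (3 * (y t - Z t)\<^sup>2 + 3 * (Z t - Z s)\<^sup>2 + 3 * (Z s - y s)\<^sup>2)"
      by (rule ennreal_leI)
    also have "\<dots> = 3 * ennreal ((y t - Z t)\<^sup>2) + 3 * ennreal ((Z t - Z s)\<^sup>2) + 3 * ennreal ((Z s - y s)\<^sup>2)"
      by (simp add: ennreal_plus ennreal_mult)
    also have "\<dots> \<le> 3 * A t + ennreal (3 * \<delta>) * V t + 3 * A (t - \<delta>)"
    proof (intro add_mono)
      show "3 * ennreal ((y t - Z t)\<^sup>2) \<le> 3 * A t"
        using t by (simp add: A_def power2_commute)
      have "ennreal ((Z t - Z s)\<^sup>2) \<le> ennreal (t - s) * (\<integral>\<^sup>+r\<in>{s<..t}. ennreal ((g r)\<^sup>2) \<partial>lborel)"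
        unfolding Z_diff[OF s(1,2)] using s by (intro set_integral_squared_le) auto
      also have "\<dots> \<le> ennreal \<delta> * V t"
        unfolding V_def using s
        by (intro mult_mono nn_integral_mono ennreal_leI) (auto simp: indicator_def)
      finally show "3 * ennreal ((Z t - Z s)\<^sup>2) \<le> ennreal (3 * \<delta>) * V t"
        using \<delta> by (simp add: ennreal_mult mult.assoc mult_left_mono)
      \<comment> \<open>If the lag reaches back to time 0 or beyond, then \<open>s = 0\<close>,
        where state and target both vanish.\<close>
      show "3 * ennreal ((Z s - y s)\<^sup>2) \<le> 3 * A (t - \<delta>)"
      proof (cases "t \<le> \<delta>")
        case True
        then show ?thesis by (simp add: s_def Z0 y(2))
      next
        case False
        then show ?thesis using t \<delta> by (simp add: A_def s_def)
      qed
    qed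
    finally show ?thesis
      using t by (simp add: s_def)
  qed
  then have "(\<integral>\<^sup>+t\<in>{0..T}. ennreal ((y t - y (max 0 (t - \<delta>)))\<^sup>2) \<partial>lborel)
      \<le> (\<integral>\<^sup>+t. 3 * A t + ennreal (3 * \<delta>) * V t + 3 * A (t - \<delta>) \<partial>lborel)"
    by (intro nn_integral_mono) auto
  also have "\<dots> = 3 * (\<integral>\<^sup>+t. A t \<partial>lborel) + ennreal (3 * \<delta>) * (\<integral>\<^sup>+t. V t \<partial>lborel)
      + 3 * (\<integral>\<^sup>+t. A (t - \<delta>) \<partial>lborel)"
    by (simp add: nn_integral_add nn_integral_cmult)
  also have "(\<integral>\<^sup>+t. A (t - \<delta>) \<partial>lborel) = (\<integral>\<^sup>+t. A t \<partial>lborel)"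
    using nn_integral_real_affine[of A 1 "-\<delta>"] by simp
  also have "(\<integral>\<^sup>+t. V t \<partial>lborel) = ennreal \<delta> * (\<integral>\<^sup>+s. ennreal ((g s)\<^sup>2) \<partial>lborel)"
    unfolding V_def using \<delta> by (intro nn_integral_moving_window) auto
  also have "(\<integral>\<^sup>+s. ennreal ((g s)\<^sup>2) \<partial>lborel) = (\<integral>\<^sup>+t\<in>{0..T}. ennreal ((u t)\<^sup>2) \<partial>lborel)"
    by (intro nn_integral_cong) (auto simp: g_def)
  also have "(\<integral>\<^sup>+t. A t \<partial>lborel) = (\<integral>\<^sup>+t\<in>{0..T}. ennreal ((X t - y t)\<^sup>2) \<partial>lborel)"
    by (intro nn_integral_cong) (auto simp: A_def XZ)
  finally show ?thesis
    using \<delta> by (simp add: ennreal_mult power2_eq_square algebra_simps flip: distrib_right)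
qed

section \<open>Exponential smoothing of a path\<close>

text \<open>The solution of \<open>\<epsilon> X' = y - X\<close>, \<open>X 0 = 0\<close>.\<close>

definition exponential_smoothing :: "real \<Rightarrow> (real \<Rightarrow> real) \<Rightarrow> real \<Rightarrow> real" where
  "exponential_smoothing \<epsilon> y t = (LINT s:{0..t}|lborel. exp (- (t - s) / \<epsilon>) / \<epsilon> * y s)"

lemma exponential_smoothing_0: "exponential_smoothing \<epsilon> y 0 = 0"
proof -
  have "AE s in lborel. indicator {0..0::real} s *\<^sub>R (exp (- (0 - s) / \<epsilon>) / \<epsilon> * y s) = (0::real)"
    by (intro AE_I[where N="{0}"]) (auto simp: indicator_def)
  then show ?thesis
    unfolding exponential_smoothing_def set_lebesgue_integral_def by (intro integral_eq_zero_AE) simp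
qed

text \<open>Once \<open>exp (- t / \<epsilon>) / \<epsilon>\<close> is factored out of the kernel,
  \<open>t\<close> remains only as the upper limit of the integral; the fundamental theorem of
  calculus and the product rule then give the equation.\<close>

lemma exponential_smoothing_has_derivative:
  assumes y: "continuous_on {0..T} y" and \<epsilon>: "\<epsilon> > 0" and t: "t \<in> {0..T}"
  shows "(exponential_smoothing \<epsilon> y has_real_derivative (y t - exponential_smoothing \<epsilon> y t) / \<epsilon>)
    (at t within {0..T})"
proof -
  let ?h = "\<lambda>s. exp (s / \<epsilon>) * y s"
  define I where "I t = integral {0..t} ?h" for t
  have h: "continuous_on {0..T} ?h"
    using \<epsilon> by (intro continuous_intros y) auto
  have eq: "exponential_smoothing \<epsilon> y t = exp (- t / \<epsilon>) / \<epsilon> * I t" if "t \<in> {0..T}" for t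
  proof -
    have "set_integrable lborel {0..t} ?h"
      using that by (intro borel_integrable_atLeastAtMost' continuous_on_subset[OF h]) auto
    then have "I t = (LINT s:{0..t}|lborel. ?h s)"
      unfolding I_def using set_borel_integral_eq_integral(2) by metis
    moreover have "exponential_smoothing \<epsilon> y t = (LINT s:{0..t}|lborel. exp (- t / \<epsilon>) / \<epsilon> * ?h s)"
      unfolding exponential_smoothing_def set_lebesgue_integral_def
      by (intro Bochner_Integration.integral_cong)
        (auto simp: diff_divide_distrib exp_diff exp_minus field_simps)
    ultimately show ?thesis by simp
  qed
  have "(I has_real_derivative ?h t) (at t within {0..T})"
    unfolding I_def using h t by (rule integral_has_real_derivative)
  then have "((\<lambda>t. exp (- t / \<epsilon>) / \<epsilon> * I t) has_real_derivative
      (exp (- t / \<epsilon>) / \<epsilon> * ?h t + (exp (- t / \<epsilon>) * (- 1 / \<epsilon>) / \<epsilon>) * I t)) (at t within {0..T})"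
    using \<epsilon> by (auto intro!: derivative_eq_intros simp: field_simps)
  also have "exp (- t / \<epsilon>) / \<epsilon> * ?h t + (exp (- t / \<epsilon>) * (- 1 / \<epsilon>) / \<epsilon>) * I t
      = (y t - exponential_smoothing \<epsilon> y t) / \<epsilon>"
    using \<epsilon> t by (simp add: eq exp_minus field_simps)
  finally show ?thesis
    by (rule has_field_derivative_transform_within[OF _ zero_less_one t]) (simp add: eq)
qed

lemma continuous_on_exponential_smoothing:
  assumes "continuous_on {0..T} y" "\<epsilon> > 0"
  shows "continuous_on {0..T} (exponential_smoothing \<epsilon> y)"
  by (rule DERIV_continuous_on[OF exponential_smoothing_has_derivative[OF assms]])

text \<open>This identifies the state driven by the feedback rate: integrating the differential
  equation from the initial value 0 recovers the smoothed path.\<close>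

lemma integral_exponential_smoothing_rate:
  assumes y: "continuous_on {0..T} y" and \<epsilon>: "\<epsilon> > 0" and t: "t \<in> {0..T}"
  shows "(LINT s:{0..t}|lborel. (y s - exponential_smoothing \<epsilon> y s) / \<epsilon>) = exponential_smoothing \<epsilon> y t"
proof -
  have sub: "{0..t} \<subseteq> {0..T}" using t by auto
  have "(\<integral>s. indicator {0..t} s *\<^sub>R ((y s - exponential_smoothing \<epsilon> y s) / \<epsilon>) \<partial>lborel)
      = exponential_smoothing \<epsilon> y t - exponential_smoothing \<epsilon> y 0"
  proof (rule integral_FTC_atLeastAtMost)
    show "0 \<le> t" using t by simp
    show "continuous_on {0..t} (\<lambda>s. (y s - exponential_smoothing \<epsilon> y s) / \<epsilon>)"
      using \<epsilon> by (intro continuous_intros continuous_on_subset[OF y sub]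
          continuous_on_subset[OF continuous_on_exponential_smoothing[OF y \<epsilon>] sub]) auto
    fix s assume "0 \<le> s" "s \<le> t"
    then have "s \<in> {0..T}" using sub by auto
    from exponential_smoothing_has_derivative[OF y \<epsilon> this]
    show "(exponential_smoothing \<epsilon> y has_vector_derivative (y s - exponential_smoothing \<epsilon> y s) / \<epsilon>)
        (at s within {0..t})"
      unfolding has_real_derivative_iff_has_vector_derivative[symmetric]
      by (rule DERIV_subset[OF _ sub])
  qed
  then show ?thesis
    by (simp add: set_lebesgue_integral_def exponential_smoothing_0)
qed

text \<open>With \<open>r = t - s\<close> the kernel becomes the density of the lag. On
  \<open>{0..t}\<close> its mass falls short of 1 by \<open>exp (- t / \<epsilon>)\<close>; this is
  the probability of a lag beyond \<open>t\<close>, where \<open>y (max 0 (t - r)) = y 0 = 0\<close>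
  contributes nothing to the mean.\<close>

lemma exponential_smoothing_error_le:
  assumes y: "continuous_on {0..T} y" "y 0 = 0" and \<epsilon>: "\<epsilon> > 0" and t: "t \<in> {0..T}"
  shows "ennreal ((exponential_smoothing \<epsilon> y t - y t)\<^sup>2)
    \<le> (\<integral>\<^sup>+r. ennreal (exponential_density (1 / \<epsilon>) r) * ennreal ((y t - y (max 0 (t - r)))\<^sup>2) \<partial>lborel)"
proof -
  let ?w = "exponential_density (1 / \<epsilon>)"
  define N where "N = density lborel (\<lambda>r. ennreal (?w r))"
  interpret N: prob_space N
    unfolding N_def using \<epsilon> by (intro prob_space_exponential_density) simp
  \<comment> \<open>Clamping the time makes the path continuous and bounded on the whole line, hence
    integrable for the law \<open>N\<close> of the lag after any reflection and shift.\<close>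
  define z where "z s = y (max 0 (min T s))" for s
  have T: "0 \<le> T" using t by auto
  have zc: "continuous_on UNIV z"
    unfolding z_def by (intro continuous_on_compose2[OF y(1)] continuous_intros) (use T in auto)
  then have [measurable]: "z \<in> borel_measurable borel"
    by (rule borel_measurable_continuous_onI)
  obtain C where "\<forall>x\<in>y ` {0..T}. norm x \<le> C"
    using compact_imp_bounded[OF compact_continuous_image[OF y(1) compact_Icc]]
    unfolding bounded_iff by blast
  then have C: "\<bar>y s\<bar> \<le> C" if "s \<in> {0..T}" for s
    using that by simp
  have zC: "\<bar>z s\<bar> \<le> C" for s
    unfolding z_def using T by (intro C) auto
  have w0: "0 \<le> ?w r" for r
    using \<epsilon> by (auto simp: exponential_density_def)
  have yz: "y (max 0 (t - r)) = z (t - r)" if "r \<ge> 0" for r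
    using that t by (simp add: z_def)
  have "(\<integral>r. z (t - r) \<partial>N) = (\<integral>r. ?w r * z (t - r) \<partial>lborel)"
    unfolding N_def using w0 by (subst integral_density) auto
  also have "\<dots> = (\<integral>s. ?w (t - s) * z s \<partial>lborel)"
    by (subst lborel_integral_real_affine[of "-1" _ t]) auto
  also have "\<dots> = exponential_smoothing \<epsilon> y t"
    unfolding exponential_smoothing_def set_lebesgue_integral_def
    by (intro Bochner_Integration.integral_cong)
      (use t y(2) \<epsilon> in \<open>auto simp: z_def exponential_density_def indicator_def\<close>)
  finally have "(\<integral>r. z (t - r) - y t \<partial>N) = exponential_smoothing \<epsilon> y t - y t"
    using N.prob_space zC C[OF t]
    by (subst Bochner_Integration.integral_diff)
      (auto simp: N_def intro!: N.integrable_const_bound[where B=C, unfolded N_def])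
  then have "ennreal ((exponential_smoothing \<epsilon> y t - y t)\<^sup>2)
      \<le> emeasure N (space N) * (\<integral>\<^sup>+r. ennreal ((z (t - r) - y t)\<^sup>2) \<partial>N)"
    using N.integral_squared_le[of "\<lambda>r. z (t - r) - y t"] by (simp add: N_def)
  also have "\<dots> = (\<integral>\<^sup>+r. ennreal (?w r) * ennreal ((z (t - r) - y t)\<^sup>2) \<partial>lborel)"
    unfolding N.emeasure_space_1 by (simp add: N_def nn_integral_density)
  also have "\<dots> = (\<integral>\<^sup>+r. ennreal (?w r) * ennreal ((y t - y (max 0 (t - r)))\<^sup>2) \<partial>lborel)"
    by (intro nn_integral_cong) (use yz in \<open>auto simp: exponential_density_def power2_commute\<close>)
  finally show ?thesis .
qed

section \<open>Progressive measurability of the feedback control\<close>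

lemma space_augmented_filtration [simp]: "space (augmented_filtration M T Y t) = space M"
  by (simp add: augmented_filtration_def space_measure_of_conv)

text \<open>From \<open>s \<le> t \<le> T\<close> it follows that \<open>s \<le> min r T\<close> for
  every \<open>r > t\<close>, so the preimages under \<open>Y s\<close> are generators of each
  sigma-algebra in the intersection.\<close>

lemma adapted_augmented_filtration:
  assumes s: "s \<in> {0..t}" and t: "t \<in> {0..T}"
  shows "Y s \<in> borel_measurable (augmented_filtration M T Y t)"
proof (rule measurableI)
  fix A :: "real set" assume A: "A \<in> sets borel"
  let ?G = "\<lambda>r. {Y s -` A \<inter> space M | s A. s \<in> {0..r} \<and> A \<in> sets borel} \<union> null_sets (completion M)"
  \<comment> \<open>\<open>sigma\<close> yields the generated sigma-algebra only when the generators
    are subsets of the space; null sets of the completion are among them.\<close>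
  have G: "?G r \<subseteq> Pow (space M)" for r
    using sets.sets_into_space[of _ "completion M"] by (auto simp: null_sets_def)
  have "Y s -` A \<inter> space M \<in> sets (completed_natural_filtration M Y (min r T))" if "t < r" for r
    unfolding completed_natural_filtration_def sets_measure_of[OF G]
    using s t that A by (intro sigma_sets.Basic) fastforce
  then have "Y s -` A \<inter> space M \<in> (\<Inter>r\<in>{t<..}. sets (completed_natural_filtration M Y (min r T)))"
    by auto
  moreover have "(\<Inter>r\<in>{t<..}. sets (completed_natural_filtration M Y (min r T))) \<subseteq> Pow (space M)"
  proof
    fix E assume "E \<in> (\<Inter>r\<in>{t<..}. sets (completed_natural_filtration M Y (min r T)))"
    then have "E \<in> sets (completed_natural_filtration M Y (min (t + 1) T))"
      by auto
    from sets.sets_into_space[OF this] show "E \<in> Pow (space M)"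
      by (simp add: completed_natural_filtration_def space_measure_of_conv)
  qed
  ultimately show "Y s -` A \<inter> space (augmented_filtration M T Y t) \<in> sets (augmented_filtration M T Y t)"
    unfolding space_augmented_filtration unfolding augmented_filtration_def by (intro in_measure_of)
qed simp

text \<open>The kernel looks only backwards, so \<open>N\<close> has to measure \<open>Y\<close> on
  \<open>{0..s}\<close> alone. It is left arbitrary to serve both for \<open>M\<close> and for the
  augmented filtration.\<close>

lemma borel_measurable_exponential_smoothing:
  fixes Y :: "real \<Rightarrow> 'a \<Rightarrow> real"
  assumes meas: "\<And>r. r \<in> {0..s} \<Longrightarrow> Y r \<in> borel_measurable N"
    and cont: "\<And>\<omega>. \<omega> \<in> space N \<Longrightarrow> continuous_on {0..s} (\<lambda>r. Y r \<omega>)"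
    and s: "0 \<le> s"
  shows "(\<lambda>\<omega>. exponential_smoothing \<epsilon> (\<lambda>r. Y r \<omega>) s) \<in> borel_measurable N"
proof -
  have [measurable]: "(\<lambda>p. Y (max 0 (min s (snd p))) (fst p)) \<in> borel_measurable (N \<Otimes>\<^sub>M lborel)"
    by (rule borel_measurable_clamped_process_compose[OF assms]) auto
  have "(\<lambda>p. if 0 \<le> snd p \<and> snd p \<le> s then exp (- (s - snd p) / \<epsilon>) / \<epsilon> * Y (max 0 (min s (snd p))) (fst p) else 0)
      \<in> borel_measurable (N \<Otimes>\<^sub>M lborel)"
    by measurable
  then have "(\<lambda>\<omega>. \<integral>r. (if 0 \<le> r \<and> r \<le> s then exp (- (s - r) / \<epsilon>) / \<epsilon> * Y (max 0 (min s r)) \<omega> else 0) \<partial>lborel)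
      \<in> borel_measurable N"
    by (intro lborel.borel_measurable_lebesgue_integral) (simp add: case_prod_unfold)
  also have "(\<lambda>\<omega>. \<integral>r. (if 0 \<le> r \<and> r \<le> s then exp (- (s - r) / \<epsilon>) / \<epsilon> * Y (max 0 (min s r)) \<omega> else 0) \<partial>lborel)
      = (\<lambda>\<omega>. exponential_smoothing \<epsilon> (\<lambda>r. Y r \<omega>) s)"
    unfolding exponential_smoothing_def set_lebesgue_integral_def
    by (intro ext Bochner_Integration.integral_cong) (auto simp: indicator_def)
  finally show ?thesis .
qed

text \<open>The rate is continuous in time, and at time \<open>s\<close> it depends only on the path
  up to \<open>s\<close>.\<close>

lemma progressively_measurable_smoothing_rate:
  assumes cont: "\<And>\<omega>. \<omega> \<in> space M \<Longrightarrow> continuous_on {0..T} (\<lambda>t. Y t \<omega>)" and \<epsilon>: "\<epsilon> > 0"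
  shows "progressively_measurable T (augmented_filtration M T Y)
    (\<lambda>t \<omega>. (Y t \<omega> - exponential_smoothing \<epsilon> (\<lambda>s. Y s \<omega>) t) / \<epsilon>)"
  unfolding progressively_measurable_def
proof
  fix t assume t: "t \<in> {0..T}"
  let ?F = "augmented_filtration M T Y t"
  have Y: "Y s \<in> borel_measurable ?F" if "s \<in> {0..t}" for s
    using adapted_augmented_filtration[OF that t] .
  have sub: "continuous_on {0..s} (\<lambda>r. Y r \<omega>)" if "\<omega> \<in> space M" "s \<le> t" for s \<omega>
    using t that by (intro continuous_on_subset[OF cont]) auto
  show "(\<lambda>(s, \<omega>). (Y s \<omega> - exponential_smoothing \<epsilon> (\<lambda>r. Y r \<omega>) s) / \<epsilon>)
      \<in> borel_measurable (restrict_space borel {0..t} \<Otimes>\<^sub>M ?F)"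
  proof (rule borel_measurable_continuous_process)
    fix s assume s: "s \<in> {0..t}"
    then show "(\<lambda>\<omega>. (Y s \<omega> - exponential_smoothing \<epsilon> (\<lambda>r. Y r \<omega>) s) / \<epsilon>) \<in> borel_measurable ?F"
      by (intro borel_measurable_divide borel_measurable_diff Y borel_measurable_const
          borel_measurable_exponential_smoothing sub) auto
  next
    fix \<omega> assume "\<omega> \<in> space ?F"
    then show "continuous_on {0..t} (\<lambda>s. (Y s \<omega> - exponential_smoothing \<epsilon> (\<lambda>r. Y r \<omega>) s) / \<epsilon>)"
      using \<epsilon> by (intro continuous_intros continuous_on_exponential_smoothing sub) auto
  qed (use t in auto)
qed

section \<open>Second moments of fractional Brownian increments\<close>

text \<open>Measurability is contained in the Gaussian condition, applied to the linear combination
  with the single term \<open>B t\<close>.\<close>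

lemma fbm_measurable:
  assumes "fractional_brownian_motion M T H B" "t \<in> {0..T}"
  shows "B t \<in> borel_measurable M"
proof -
  have "gaussian_variable M (\<lambda>\<omega>. \<Sum>s\<in>{t}. 1 * B s \<omega>)"
    using assms unfolding fractional_brownian_motion_def gaussian_process_def
    by (elim conjE allE[of _ "{t}"] allE[of _ "\<lambda>_. 1"]) simp
  then show ?thesis
    by (simp add: gaussian_variable_def)
qed

text \<open>A Bochner integral is 0 when the integrand is not integrable. For distinct times the
  prescribed value is positive, which forces integrability and carries the value over to the
  nonnegative integral.\<close>

lemma fbm_increment_second_moment:
  assumes B: "fractional_brownian_motion M T H B" and st: "s \<in> {0..T}" "t \<in> {0..T}"
  shows "(\<integral>\<^sup>+\<omega>. ennreal ((B t \<omega> - B s \<omega>)\<^sup>2) \<partial>M) = ennreal (\<bar>t - s\<bar> powr (2 * H))"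
proof (cases "s = t")
  case True
  then show ?thesis by simp
next
  case False
  have eq: "(\<integral>\<omega>. (B t \<omega> - B s \<omega>)\<^sup>2 \<partial>M) = \<bar>t - s\<bar> powr (2 * H)"
    using B st unfolding fractional_brownian_motion_def by simp
  with False have "integrable M (\<lambda>\<omega>. (B t \<omega> - B s \<omega>)\<^sup>2)"
    using not_integrable_integral_eq by fastforce
  then show ?thesis
    using eq by (simp add: nn_integral_eq_integral)
qed

text \<open>Splitting at \<open>\<delta>\<close> gives \<open>\<delta> powr (p + 1) / (p + 1) + (T -
  \<delta>) * \<delta> powr p\<close>. With \<open>p = 2 * H\<close> this is the origin of the
  correction \<open>2 * H / (2 * H + 1)\<close> in the lower bound.\<close>

lemma has_integral_truncated_powr:
  fixes p \<delta> T :: real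
  assumes p: "p > 0" and \<delta>: "0 \<le> \<delta>" "\<delta> \<le> T"
  shows "((\<lambda>t. (min t \<delta>) powr p) has_integral \<delta> powr p * (T - p / (p + 1) * \<delta>)) {0..T}"
proof -
  have "((\<lambda>t. t powr p) has_integral \<delta> powr (p + 1) / (p + 1)) {0..\<delta>}"
    using p \<delta> by (intro has_integral_powr_from_0) auto
  then have 1: "((\<lambda>t. (min t \<delta>) powr p) has_integral \<delta> powr (p + 1) / (p + 1)) {0..\<delta>}"
    by (rule has_integral_eq[rotated]) auto
  have "((\<lambda>t. \<delta> powr p) has_integral (T - \<delta>) * \<delta> powr p) {\<delta>..T}"
    using has_integral_const_real[of "\<delta> powr p" \<delta> T] \<delta> by simp
  then have 2: "((\<lambda>t. (min t \<delta>) powr p) has_integral (T - \<delta>) * \<delta> powr p) {\<delta>..T}"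
    by (rule has_integral_eq[rotated]) (auto simp: min_def)
  have "\<delta> powr (p + 1) / (p + 1) + (T - \<delta>) * \<delta> powr p = \<delta> powr p * (T - p / (p + 1) * \<delta>)"
    using p \<delta> by (simp add: powr_add field_simps)
  with has_integral_combine[OF \<delta> 1 2] show ?thesis by simp
qed

text \<open>At \<open>\<delta>\<^sup>2 = 2 * \<kappa>\<close> the path estimate has the weights 6
  and \<open>6 * \<kappa>\<close>, twelve times those of the cost.\<close>

lemma ennreal_twelfth_cost:
  assumes "\<kappa> \<ge> 0"
  shows "ennreal (1 / 12) * (6 * a + ennreal (6 * \<kappa>) * b) = ennreal (1 / 2) * a + ennreal (\<kappa> / 2) * b"
proof -
  have "ennreal (1 / 12) * 6 = ennreal (1 / 12 * 6)"
    by (subst ennreal_mult) auto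
  moreover have "ennreal (1 / 12) * ennreal (6 * \<kappa>) = ennreal (\<kappa> / 2)"
    using assms by (subst ennreal_mult[symmetric]) auto
  ultimately show ?thesis
    by (simp add: distrib_left mult.assoc[symmetric])
qed

text \<open>The quantity common to both bounds: the lower one takes it at a fixed lag, the upper one
  averages it over an exponential lag. Before time 0 the path is frozen at its initial
  value.\<close>

definition squared_lag :: "real \<Rightarrow> (real \<Rightarrow> real) \<Rightarrow> real \<Rightarrow> ennreal" where
  "squared_lag T y r = (\<integral>\<^sup>+t\<in>{0..T}. ennreal ((y t - y (max 0 (t - r)))\<^sup>2) \<partial>lborel)"

text \<open>Lag and outcome are both functions of a parameter, so that one statement covers a fixed
  lag on \<open>M\<close> as well as the joint dependence on lag and outcome needed for
  Tonelli.\<close>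

lemma borel_measurable_squared_lag:
  fixes Y :: "real \<Rightarrow> 'a \<Rightarrow> real"
  assumes Y: "\<And>t. t \<in> {0..T} \<Longrightarrow> Y t \<in> borel_measurable M"
    "\<And>\<omega>. \<omega> \<in> space M \<Longrightarrow> continuous_on {0..T} (\<lambda>t. Y t \<omega>)" "0 \<le> T"
    and g [measurable]: "g \<in> borel_measurable K" and g0: "\<And>x. 0 \<le> g x" and h [measurable]: "h \<in> K \<rightarrow>\<^sub>M M"
  shows "(\<lambda>x. squared_lag T (\<lambda>t. Y t (h x)) (g x)) \<in> borel_measurable K"
proof -
  note clamped = borel_measurable_clamped_process_compose[OF Y]
  have [measurable]: "(\<lambda>p. Y (max 0 (min T (snd p))) (h (fst p))) \<in> borel_measurable (K \<Otimes>\<^sub>M lborel)"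
    by (rule clamped) measurable
  have [measurable]: "(\<lambda>p. Y (max 0 (min T (snd p - g (fst p)))) (h (fst p))) \<in> borel_measurable (K \<Otimes>\<^sub>M lborel)"
    by (rule clamped) measurable
  let ?f = "\<lambda>x t. if 0 \<le> t \<and> t \<le> T
    then ennreal ((Y (max 0 (min T t)) (h x) - Y (max 0 (min T (t - g x))) (h x))\<^sup>2) else 0"
  have "(\<lambda>p. ?f (fst p) (snd p)) \<in> borel_measurable (K \<Otimes>\<^sub>M lborel)"
    by measurable
  then have "(\<lambda>x. \<integral>\<^sup>+t. ?f x t \<partial>lborel) \<in> borel_measurable K"
    by (intro lborel.borel_measurable_nn_integral) (simp add: case_prod_unfold)
  also have "(\<lambda>x. \<integral>\<^sup>+t. ?f x t \<partial>lborel) = (\<lambda>x. squared_lag T (\<lambda>t. Y t (h x)) (g x))"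
  proof (intro ext)
    fix x
    show "(\<integral>\<^sup>+t. ?f x t \<partial>lborel) = squared_lag T (\<lambda>t. Y t (h x)) (g x)"
      unfolding squared_lag_def using g0[of x]
      by (intro nn_integral_cong) (auto simp: indicator_def min_def)
  qed
  finally show ?thesis .
qed

text \<open>The times \<open>max 0 (t - r)\<close> and \<open>t\<close> are \<open>min t r\<close>
  apart; Tonelli moves the expectation inside the time integral.\<close>

lemma fbm_expected_squared_lag:
  assumes M: "prob_space M" and T: "0 \<le> T" and B: "fractional_brownian_motion M T H B" and r: "0 \<le> r"
  shows "(\<integral>\<^sup>+\<omega>. squared_lag T (\<lambda>t. B t \<omega>) r \<partial>M)
    = (\<integral>\<^sup>+t\<in>{0..T}. ennreal ((min t r) powr (2 * H)) \<partial>lborel)"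
proof -
  interpret prob_space M by fact
  interpret P: pair_sigma_finite lborel M ..
  have Y: "\<And>t. t \<in> {0..T} \<Longrightarrow> B t \<in> borel_measurable M"
    "\<And>\<omega>. \<omega> \<in> space M \<Longrightarrow> continuous_on {0..T} (\<lambda>t. B t \<omega>)"
    using fbm_measurable[OF B] B unfolding fractional_brownian_motion_def by auto
  note clamped = borel_measurable_clamped_process_compose[OF Y T]
  have [measurable]: "(\<lambda>p. B (max 0 (min T (fst p))) (snd p)) \<in> borel_measurable (lborel \<Otimes>\<^sub>M M)"
    by (rule clamped) measurable
  have [measurable]: "(\<lambda>p. B (max 0 (min T (fst p - r))) (snd p)) \<in> borel_measurable (lborel \<Otimes>\<^sub>M M)"
    by (rule clamped) measurable
  let ?f = "\<lambda>t \<omega>. if 0 \<le> t \<and> t \<le> T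
    then ennreal ((B (max 0 (min T t)) \<omega> - B (max 0 (min T (t - r))) \<omega>)\<^sup>2) else 0"
  have f: "(\<lambda>p. ?f (fst p) (snd p)) \<in> borel_measurable (lborel \<Otimes>\<^sub>M M)"
    by measurable
  have "(\<integral>\<^sup>+\<omega>. squared_lag T (\<lambda>t. B t \<omega>) r \<partial>M) = (\<integral>\<^sup>+\<omega>. (\<integral>\<^sup>+t. ?f t \<omega> \<partial>lborel) \<partial>M)"
    unfolding squared_lag_def using r
    by (intro nn_integral_cong) (auto simp: indicator_def min_def)
  also have "\<dots> = (\<integral>\<^sup>+t. (\<integral>\<^sup>+\<omega>. ?f t \<omega> \<partial>M) \<partial>lborel)"
    by (rule P.Fubini') (use f in \<open>simp add: case_prod_unfold\<close>)
  also have "\<dots> = (\<integral>\<^sup>+t\<in>{0..T}. ennreal ((min t r) powr (2 * H)) \<partial>lborel)"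
  proof (rule nn_integral_cong)
    fix t :: real
    show "(\<integral>\<^sup>+\<omega>. ?f t \<omega> \<partial>M) = ennreal ((min t r) powr (2 * H)) * indicator {0..T} t"
    proof (cases "t \<in> {0..T}")
      case True
      then have eq: "max 0 (min T t) = t" "max 0 (min T (t - r)) = max 0 (t - r)"
          "\<bar>t - max 0 (t - r)\<bar> = min t r" and mem: "max 0 (t - r) \<in> {0..T}"
        using r by auto
      show ?thesis
        using fbm_increment_second_moment[OF B mem True] True by (simp add: eq)
    qed auto
  qed
  finally show ?thesis .
qed

text \<open>The lag is written \<open>max 0 r\<close> because measurability of
  \<open>squared_lag\<close> is available for nonnegative lags; the exponential density vanishes at
  negative \<open>r\<close>, so the value is unaffected.\<close>

lemma integrated_smoothing_error_le:
  assumes y: "continuous_on {0..T} y" "y 0 = 0" and T: "0 \<le> T" and \<epsilon>: "\<epsilon> > 0"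
  shows "(\<integral>\<^sup>+t\<in>{0..T}. ennreal ((exponential_smoothing \<epsilon> y t - y t)\<^sup>2) \<partial>lborel)
    \<le> (\<integral>\<^sup>+r. ennreal (exponential_density (1 / \<epsilon>) r) * squared_lag T y (max 0 r) \<partial>lborel)"
proof -
  let ?w = "\<lambda>r. ennreal (exponential_density (1 / \<epsilon>) r)"
  define z where "z s = y (max 0 (min T s))" for s
  have "continuous_on UNIV z"
    unfolding z_def by (intro continuous_on_compose2[OF y(1)] continuous_intros) (use T in auto)
  then have [measurable]: "z \<in> borel_measurable borel"
    by (rule borel_measurable_continuous_onI)
  let ?f = "\<lambda>r t. if 0 \<le> t \<and> t \<le> T then ennreal ((z t - z (t - max 0 r))\<^sup>2) else 0"
  have "(\<integral>\<^sup>+t\<in>{0..T}. ennreal ((exponential_smoothing \<epsilon> y t - y t)\<^sup>2) \<partial>lborel)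
      \<le> (\<integral>\<^sup>+t. (\<integral>\<^sup>+r. ?w r * ?f r t \<partial>lborel) \<partial>lborel)"
  proof (rule nn_integral_mono)
    fix t :: real
    show "ennreal ((exponential_smoothing \<epsilon> y t - y t)\<^sup>2) * indicator {0..T} t
        \<le> (\<integral>\<^sup>+r. ?w r * ?f r t \<partial>lborel)"
    proof (cases "t \<in> {0..T}")
      case t: True
      have "(\<integral>\<^sup>+r. ?w r * ennreal ((y t - y (max 0 (t - r)))\<^sup>2) \<partial>lborel)
          = (\<integral>\<^sup>+r. ?w r * ?f r t \<partial>lborel)"
      proof (rule nn_integral_cong)
        fix r :: real
        show "?w r * ennreal ((y t - y (max 0 (t - r)))\<^sup>2) = ?w r * ?f r t"
        proof (cases "0 \<le> r")
          case True
          then have "min T t = t" "min T (t - r) = t - r"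
            using t by auto
          then show ?thesis
            using t True by (simp add: z_def)
        qed (simp add: exponential_density_def)
      qed
      with exponential_smoothing_error_le[OF y \<epsilon> t] t show ?thesis by simp
    qed simp
  qed
  also have "\<dots> = (\<integral>\<^sup>+r. (\<integral>\<^sup>+t. ?w r * ?f r t \<partial>lborel) \<partial>lborel)"
    by (rule lborel_pair.Fubini') measurable
  also have "\<dots> = (\<integral>\<^sup>+r. ?w r * (\<integral>\<^sup>+t. ?f r t \<partial>lborel) \<partial>lborel)"
    by (intro nn_integral_cong nn_integral_cmult) measurable
  also have "\<dots> = (\<integral>\<^sup>+r. ?w r * squared_lag T y (max 0 r) \<partial>lborel)"
  proof (rule nn_integral_cong)
    fix r :: real
    have "(\<integral>\<^sup>+t. ?f r t \<partial>lborel) = squared_lag T y (max 0 r)"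
      unfolding squared_lag_def z_def
      by (intro nn_integral_cong) (auto simp: indicator_def min_def)
    then show "?w r * (\<integral>\<^sup>+t. ?f r t \<partial>lborel) = ?w r * squared_lag T y (max 0 r)"
      by simp
  qed
  finally show ?thesis .
qed

text \<open>By \<open>min t r \<le> r\<close> the expected squared lag is at most
  \<open>T * r powr (2 * H)\<close>, which leaves a moment of the exponential law.\<close>

lemma fbm_expected_exponential_lag_le:
  assumes M: "prob_space M" and T: "0 \<le> T" and H: "H > 0"
    and B: "fractional_brownian_motion M T H B" and \<epsilon>: "\<epsilon> > 0"
  shows "(\<integral>\<^sup>+\<omega>. (\<integral>\<^sup>+r. ennreal (exponential_density (1 / \<epsilon>) r)
        * squared_lag T (\<lambda>t. B t \<omega>) (max 0 r) \<partial>lborel) \<partial>M)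
    \<le> ennreal (T * Gamma (2 * H + 1) * \<epsilon> powr (2 * H))"
proof -
  interpret prob_space M by fact
  interpret P: pair_sigma_finite lborel M ..
  let ?w = "\<lambda>r. ennreal (exponential_density (1 / \<epsilon>) r)"
  have Y: "\<And>t. t \<in> {0..T} \<Longrightarrow> B t \<in> borel_measurable M"
    "\<And>\<omega>. \<omega> \<in> space M \<Longrightarrow> continuous_on {0..T} (\<lambda>t. B t \<omega>)"
    using fbm_measurable[OF B] B unfolding fractional_brownian_motion_def by auto
  have [measurable]: "(\<lambda>p. squared_lag T (\<lambda>t. B t (snd p)) (max 0 (fst p))) \<in> borel_measurable (lborel \<Otimes>\<^sub>M M)"
    by (rule borel_measurable_squared_lag[OF Y T]) auto
  have [measurable]: "(\<lambda>\<omega>. squared_lag T (\<lambda>t. B t \<omega>) (max 0 r)) \<in> borel_measurable M" for r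
    by (rule borel_measurable_squared_lag[OF Y T]) auto
  have "(\<integral>\<^sup>+\<omega>. (\<integral>\<^sup>+r. ?w r * squared_lag T (\<lambda>t. B t \<omega>) (max 0 r) \<partial>lborel) \<partial>M)
      = (\<integral>\<^sup>+r. (\<integral>\<^sup>+\<omega>. ?w r * squared_lag T (\<lambda>t. B t \<omega>) (max 0 r) \<partial>M) \<partial>lborel)"
    by (rule P.Fubini') (simp add: case_prod_unfold)
  also have "\<dots> = (\<integral>\<^sup>+r. ?w r * (\<integral>\<^sup>+\<omega>. squared_lag T (\<lambda>t. B t \<omega>) (max 0 r) \<partial>M) \<partial>lborel)"
    by (intro nn_integral_cong nn_integral_cmult) measurable
  also have "\<dots> \<le> (\<integral>\<^sup>+r. ennreal T * (?w r * ennreal (r powr (2 * H))) \<partial>lborel)"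
  proof (rule nn_integral_mono)
    fix r :: real
    show "?w r * (\<integral>\<^sup>+\<omega>. squared_lag T (\<lambda>t. B t \<omega>) (max 0 r) \<partial>M)
        \<le> ennreal T * (?w r * ennreal (r powr (2 * H)))"
    proof (cases "0 \<le> r")
      case True
      have "(\<integral>\<^sup>+\<omega>. squared_lag T (\<lambda>t. B t \<omega>) r \<partial>M)
          = (\<integral>\<^sup>+t\<in>{0..T}. ennreal ((min t r) powr (2 * H)) \<partial>lborel)"
        by (rule fbm_expected_squared_lag[OF M T B True])
      also have "\<dots> \<le> (\<integral>\<^sup>+t. ennreal (r powr (2 * H)) * indicator {0..T} t \<partial>lborel)"
        using True H by (intro nn_integral_mono) (auto simp: indicator_def intro!: ennreal_leI powr_mono2)
      also have "\<dots> = ennreal T * ennreal (r powr (2 * H))"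
        using T by (simp add: nn_integral_cmult_indicator) (rule mult.commute)
      finally have "?w r * (\<integral>\<^sup>+\<omega>. squared_lag T (\<lambda>t. B t \<omega>) r \<partial>M)
          \<le> ?w r * (ennreal T * ennreal (r powr (2 * H)))"
        by (rule mult_left_mono) simp
      then show ?thesis
        using True by (simp add: mult.left_commute)
    qed (simp add: exponential_density_def)
  qed
  also have "\<dots> = ennreal T * ennreal (Gamma (2 * H + 1) * \<epsilon> powr (2 * H))"
    using H \<epsilon> by (simp add: nn_integral_cmult exponential_moment)
  also have "\<dots> = ennreal (T * Gamma (2 * H + 1) * \<epsilon> powr (2 * H))"
    using T by (simp add: ennreal_mult'[symmetric] mult.assoc)
  finally show ?thesis .
qed

section \<open>The two bounds on the value\<close>

lemma tracking_value_lower_bound: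
  assumes M: "prob_space M" and H: "H > 0" and B: "fractional_brownian_motion M T H B"
    and \<kappa>: "0 < \<kappa>" "sqrt (2 * \<kappa>) \<le> T"
  shows "ennreal (\<kappa> powr H / 12 *
      (T * 2 powr H - 2 * H / (2 * H + 1) * 2 powr (H + 1 / 2) * sqrt \<kappa>))
    \<le> tracking_value M T (augmented_filtration M T B) B 0 \<kappa>"
  unfolding tracking_value_def
proof (rule INF_greatest)
  fix u assume u: "u \<in> admissible_controls M T (augmented_filtration M T B)"
  define \<delta> where "\<delta> = sqrt (2 * \<kappa>)"
  have \<delta>: "0 < \<delta>" "\<delta> \<le> T" "\<delta>\<^sup>2 = 2 * \<kappa>"
    using \<kappa> by (auto simp: \<delta>_def)
  then have T: "0 \<le> T" by simp
  have Y: "\<And>t. t \<in> {0..T} \<Longrightarrow> B t \<in> borel_measurable M"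
    "\<And>\<omega>. \<omega> \<in> space M \<Longrightarrow> continuous_on {0..T} (\<lambda>t. B t \<omega>)"
    and B0: "\<And>\<omega>. \<omega> \<in> space M \<Longrightarrow> B 0 \<omega> = 0"
    using fbm_measurable[OF B] B unfolding fractional_brownian_motion_def by auto
  have [measurable]: "(\<lambda>\<omega>. squared_lag T (\<lambda>t. B t \<omega>) \<delta>) \<in> borel_measurable M"
    by (rule borel_measurable_squared_lag[OF Y T]) (use \<delta> in auto)
  have power: "\<delta> powr (2 * H) = 2 powr H * \<kappa> powr H"
  proof -
    have "\<delta> powr (2 * H) = (\<delta>\<^sup>2) powr H"
      using \<delta> by (simp add: powr_powr[symmetric] powr_numeral)
    then show ?thesis
      using \<kappa> by (simp add: \<delta>(3) powr_mult)
  qed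
  have "\<kappa> powr H / 12 * (T * 2 powr H - 2 * H / (2 * H + 1) * 2 powr (H + 1 / 2) * sqrt \<kappa>)
      = 1 / 12 * (\<delta> powr (2 * H) * (T - 2 * H / (2 * H + 1) * \<delta>))"
  proof -
    have "2 powr (H + 1 / 2) * sqrt \<kappa> = 2 powr H * \<delta>"
      by (simp add: powr_add powr_half_sqrt \<delta>_def real_sqrt_mult)
    then have "T * 2 powr H - 2 * H / (2 * H + 1) * 2 powr (H + 1 / 2) * sqrt \<kappa>
        = 2 powr H * (T - 2 * H / (2 * H + 1) * \<delta>)"
      by (simp add: algebra_simps)
    then show ?thesis
      by (simp add: power)
  qed
  also have "ennreal \<dots> = ennreal (1 / 12) * ennreal (\<delta> powr (2 * H) * (T - 2 * H / (2 * H + 1) * \<delta>))"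
    by (rule ennreal_mult') simp
  also have "ennreal (\<delta> powr (2 * H) * (T - 2 * H / (2 * H + 1) * \<delta>))
      = (\<integral>\<^sup>+t. ennreal (indicator {0..T} t * (min t \<delta>) powr (2 * H)) \<partial>lborel)"
    by (rule nn_integral_has_integral_lebesgue[symmetric])
      (use has_integral_truncated_powr[of "2 * H" \<delta> T] H \<delta> in auto)
  also have "\<dots> = (\<integral>\<^sup>+t\<in>{0..T}. ennreal ((min t \<delta>) powr (2 * H)) \<partial>lborel)"
    by (intro nn_integral_cong) (auto simp: indicator_def)
  also have "\<dots> = (\<integral>\<^sup>+\<omega>. squared_lag T (\<lambda>t. B t \<omega>) \<delta> \<partial>M)"
    using \<delta> by (intro fbm_expected_squared_lag[OF M T B, symmetric]) auto
  also have "ennreal (1 / 12) * \<dots> = (\<integral>\<^sup>+\<omega>. ennreal (1 / 12) * squared_lag T (\<lambda>t. B t \<omega>) \<delta> \<partial>M)"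
    by (rule nn_integral_cmult[symmetric]) measurable
  \<comment> \<open>\<open>nn_integral\<close> is defined for arbitrary integrands and has the same
    value over \<open>M\<close> and over its completion, so comparing the integrands at each outcome
    suffices.\<close>
  also have "\<dots> \<le> tracking_cost M T B 0 \<kappa> u"
    unfolding tracking_cost_def nn_integral_completion
  proof (rule nn_integral_mono)
    fix \<omega> assume \<omega>: "\<omega> \<in> space M"
    let ?A = "\<integral>\<^sup>+t\<in>{0..T}. ennreal ((controlled_state 0 u t \<omega> - B t \<omega>)\<^sup>2) \<partial>lborel"
    let ?U = "\<integral>\<^sup>+t\<in>{0..T}. ennreal ((u t \<omega>)\<^sup>2) \<partial>lborel"
    \<comment> \<open>Progressive measurability at the terminal time covers the whole horizon; its
      section at \<open>\<omega>\<close> is the measurable path required by the path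
      estimate.\<close>
    have "(\<lambda>(s, \<omega>). u s \<omega>) \<in> borel_measurable (restrict_space borel {0..T} \<Otimes>\<^sub>M augmented_filtration M T B T)"
      using u T unfolding admissible_controls_def progressively_measurable_def by auto
    from measurable_Pair1[OF this, of \<omega>] \<omega>
    have "(\<lambda>s. u s \<omega>) \<in> borel_measurable (restrict_space borel {0..T})"
      by simp
    from tracking_path_lower_bound[OF \<delta>(1) Y(2)[OF \<omega>] B0[OF \<omega>] this]
    have "squared_lag T (\<lambda>t. B t \<omega>) \<delta> \<le> 6 * ?A + ennreal (6 * \<kappa>) * ?U"
      by (simp add: squared_lag_def controlled_state_def \<delta>(3))
    then have "ennreal (1 / 12) * squared_lag T (\<lambda>t. B t \<omega>) \<delta>
        \<le> ennreal (1 / 12) * (6 * ?A + ennreal (6 * \<kappa>) * ?U)"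
      by (rule mult_left_mono) simp
    also have "\<dots> = ennreal (1 / 2) * ?A + ennreal (\<kappa> / 2) * ?U"
      using \<kappa> by (intro ennreal_twelfth_cost) simp
    finally show "ennreal (1 / 12) * squared_lag T (\<lambda>t. B t \<omega>) \<delta>
        \<le> ennreal (1 / 2) * ?A + ennreal (\<kappa> / 2) * ?U" .
  qed
  finally show "ennreal (\<kappa> powr H / 12 *
      (T * 2 powr H - 2 * H / (2 * H + 1) * 2 powr (H + 1 / 2) * sqrt \<kappa>))
    \<le> tracking_cost M T B 0 \<kappa> u" .
qed

lemma tracking_value_upper_bound:
  assumes M: "prob_space M" and T: "0 \<le> T" and H: "H > 0"
    and B: "fractional_brownian_motion M T H B" and \<kappa>: "0 < \<kappa>"
  shows "tracking_value M T (augmented_filtration M T B) B 0 \<kappa>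
    \<le> ennreal (T * Gamma (2 * H + 1) * \<kappa> powr H)"
proof -
  define \<epsilon> where "\<epsilon> = sqrt \<kappa>"
  have \<epsilon>: "0 < \<epsilon>" "\<epsilon>\<^sup>2 = \<kappa>"
    using \<kappa> by (auto simp: \<epsilon>_def)
  have power: "\<epsilon> powr (2 * H) = \<kappa> powr H"
  proof -
    have "\<epsilon> powr (2 * H) = (\<epsilon>\<^sup>2) powr H"
      using \<epsilon> by (simp add: powr_powr[symmetric] powr_numeral)
    then show ?thesis by (simp add: \<epsilon>(2))
  qed
  have cont: "continuous_on {0..T} (\<lambda>t. B t \<omega>)" and B0: "B 0 \<omega> = 0" if "\<omega> \<in> space M" for \<omega>
    using B that unfolding fractional_brownian_motion_def by auto
  define S where "S t \<omega> = exponential_smoothing \<epsilon> (\<lambda>s. B s \<omega>) t" for t \<omega>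
  define u where "u t \<omega> = (B t \<omega> - S t \<omega>) / \<epsilon>" for t \<omega>
  define E where "E \<omega> = (\<integral>\<^sup>+t\<in>{0..T}. ennreal ((S t \<omega> - B t \<omega>)\<^sup>2) \<partial>lborel)" for \<omega>
  have E_le: "(\<integral>\<^sup>+\<omega>. E \<omega> \<partial>M) \<le> ennreal (T * Gamma (2 * H + 1) * \<kappa> powr H)"
  proof -
    have "(\<integral>\<^sup>+\<omega>. E \<omega> \<partial>M) \<le> (\<integral>\<^sup>+\<omega>. (\<integral>\<^sup>+r. ennreal (exponential_density (1 / \<epsilon>) r)
        * squared_lag T (\<lambda>t. B t \<omega>) (max 0 r) \<partial>lborel) \<partial>M)"
      unfolding E_def S_def
      by (intro nn_integral_mono integrated_smoothing_error_le cont B0 T \<epsilon>)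
    also have "\<dots> \<le> ennreal (T * Gamma (2 * H + 1) * \<epsilon> powr (2 * H))"
      by (rule fbm_expected_exponential_lag_le[OF M T H B \<epsilon>(1)])
    finally show ?thesis by (simp add: power)
  qed
  have Y: "B t \<in> borel_measurable M" if "t \<in> {0..T}" for t
    by (rule fbm_measurable[OF B that])
  \<comment> \<open>Joint measurability of the error in outcome and time serves twice: it makes
    \<open>E\<close> measurable, and its sections in time allow \<open>1 / \<kappa>\<close> to be
    pulled out of the energy.\<close>
  have "(\<lambda>p. S (max 0 (min T (snd p))) (fst p) - B (max 0 (min T (snd p))) (fst p))
      \<in> borel_measurable (M \<Otimes>\<^sub>M lborel)"
    unfolding S_def
  proof (rule borel_measurable_clamped_process_compose[where
        Y = "\<lambda>t \<omega>. exponential_smoothing \<epsilon> (\<lambda>s. B s \<omega>) t - B t \<omega>"])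
    fix t assume t: "t \<in> {0..T}"
    then show "(\<lambda>\<omega>. exponential_smoothing \<epsilon> (\<lambda>s. B s \<omega>) t - B t \<omega>) \<in> borel_measurable M"
      by (intro borel_measurable_diff borel_measurable_exponential_smoothing Y continuous_on_subset[OF cont]) auto
  next
    fix \<omega> assume "\<omega> \<in> space M"
    then show "continuous_on {0..T} (\<lambda>t. exponential_smoothing \<epsilon> (\<lambda>s. B s \<omega>) t - B t \<omega>)"
      by (intro continuous_intros continuous_on_exponential_smoothing cont \<epsilon>)
  qed (use T in auto)
  then have "(\<lambda>p. if 0 \<le> snd p \<and> snd p \<le> T then ennreal ((S (max 0 (min T (snd p))) (fst p)
      - B (max 0 (min T (snd p))) (fst p))\<^sup>2) else 0) \<in> borel_measurable (M \<Otimes>\<^sub>M lborel)"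
    by measurable
  also have "(\<lambda>p. if 0 \<le> snd p \<and> snd p \<le> T then ennreal ((S (max 0 (min T (snd p))) (fst p)
      - B (max 0 (min T (snd p))) (fst p))\<^sup>2) else 0)
    = (\<lambda>(\<omega>, t). ennreal ((S t \<omega> - B t \<omega>)\<^sup>2) * indicator {0..T} t)"
    by (auto simp: indicator_def)
  finally have joint: "(\<lambda>(\<omega>, t). ennreal ((S t \<omega> - B t \<omega>)\<^sup>2) * indicator {0..T} t)
      \<in> borel_measurable (M \<Otimes>\<^sub>M lborel)" .
  have E_meas: "E \<in> borel_measurable M"
    unfolding E_def using joint by (rule lborel.borel_measurable_nn_integral)
  have path_U: "(\<integral>\<^sup>+t\<in>{0..T}. ennreal ((u t \<omega>)\<^sup>2) \<partial>lborel) = ennreal (1 / \<kappa>) * E \<omega>" if \<omega>: "\<omega> \<in> space M" for \<omega>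
  proof -
    have "(\<integral>\<^sup>+t\<in>{0..T}. ennreal ((u t \<omega>)\<^sup>2) \<partial>lborel)
        = (\<integral>\<^sup>+t. ennreal (1 / \<kappa>) * (ennreal ((S t \<omega> - B t \<omega>)\<^sup>2) * indicator {0..T} t) \<partial>lborel)"
      using \<kappa> by (intro nn_integral_cong)
        (auto simp: u_def power_divide \<epsilon>(2) indicator_def ennreal_mult[symmetric] power2_commute)
    also have "\<dots> = ennreal (1 / \<kappa>) * E \<omega>"
      unfolding E_def using measurable_Pair2[OF joint \<omega>] by (intro nn_integral_cmult) simp
    finally show ?thesis .
  qed
  have state: "controlled_state 0 u t \<omega> = S t \<omega>" if "t \<in> {0..T}" "\<omega> \<in> space M" for t \<omega>
    using integral_exponential_smoothing_rate[OF cont[OF that(2)] \<epsilon>(1) that(1)]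
    by (simp add: controlled_state_def u_def S_def)
  have cost: "tracking_cost M T B 0 \<kappa> u = (\<integral>\<^sup>+\<omega>. E \<omega> \<partial>M)"
    unfolding tracking_cost_def nn_integral_completion
  proof (rule nn_integral_cong)
    fix \<omega> assume \<omega>: "\<omega> \<in> space M"
    have "(\<integral>\<^sup>+t\<in>{0..T}. ennreal ((controlled_state 0 u t \<omega> - B t \<omega>)\<^sup>2) \<partial>lborel) = E \<omega>"
      unfolding E_def using state[OF _ \<omega>] by (intro nn_integral_cong) (auto simp: indicator_def)
    moreover have "ennreal (\<kappa> / 2) * (ennreal (1 / \<kappa>) * E \<omega>) = ennreal (1 / 2) * E \<omega>"
      using \<kappa> by (simp add: mult.assoc[symmetric] ennreal_mult[symmetric])
    moreover have "ennreal (1 / 2) * E \<omega> + ennreal (1 / 2) * E \<omega> = E \<omega>"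
    proof -
      have "ennreal (1 / 2) + ennreal (1 / 2) = 1"
        by (subst ennreal_plus[symmetric]) simp_all
      then show ?thesis
        by (simp only: distrib_right[symmetric] mult_1_left)
    qed
    ultimately show "ennreal (1 / 2) * (\<integral>\<^sup>+t\<in>{0..T}. ennreal ((controlled_state 0 u t \<omega> - B t \<omega>)\<^sup>2) \<partial>lborel)
        + ennreal (\<kappa> / 2) * (\<integral>\<^sup>+t\<in>{0..T}. ennreal ((u t \<omega>)\<^sup>2) \<partial>lborel) = E \<omega>"
      using \<omega> by (simp only: path_U)
  qed
  have "u \<in> admissible_controls M T (augmented_filtration M T B)"
    unfolding admissible_controls_def
  proof (intro CollectI conjI)
    show "progressively_measurable T (augmented_filtration M T B) u"
      using progressively_measurable_smoothing_rate[OF cont \<epsilon>(1)] unfolding u_def S_def .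
  next
    have "(\<integral>\<^sup>+\<omega>. (\<integral>\<^sup>+t\<in>{0..T}. ennreal ((u t \<omega>)\<^sup>2) \<partial>lborel) \<partial>completion M)
        = (\<integral>\<^sup>+\<omega>. ennreal (1 / \<kappa>) * E \<omega> \<partial>M)"
      unfolding nn_integral_completion by (intro nn_integral_cong path_U)
    also have "\<dots> = ennreal (1 / \<kappa>) * (\<integral>\<^sup>+\<omega>. E \<omega> \<partial>M)"
      by (rule nn_integral_cmult[OF E_meas])
    \<comment> \<open>The energy is the squared error divided by \<open>\<kappa>\<close>, so the
      error bound also yields admissibility.\<close>
    also have "\<dots> < \<infinity>"
      using order.strict_trans1[OF E_le ennreal_less_top] by (simp add: ennreal_mult_less_top)
    finally show "(\<integral>\<^sup>+\<omega>. (\<integral>\<^sup>+t\<in>{0..T}. ennreal ((u t \<omega>)\<^sup>2) \<partial>lborel) \<partial>completion M) < \<infinity>" .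
  qed
  then have "tracking_value M T (augmented_filtration M T B) B 0 \<kappa> \<le> tracking_cost M T B 0 \<kappa> u"
    unfolding tracking_value_def by (rule INF_lower)
  also have "\<dots> \<le> ennreal (T * Gamma (2 * H + 1) * \<kappa> powr H)"
    unfolding cost by (rule E_le)
  finally show ?thesis .
qed

theorem proposition2p11:
  fixes M :: "'a measure" and B :: "real \<Rightarrow> 'a \<Rightarrow> real" and T H :: real
    and v :: "real \<Rightarrow> ennreal"
  assumes "prob_space M"
    and "T > 0"
    and "H \<in> {0<..<1}"
    and "fractional_brownian_motion M T H B"
  defines "v \<equiv> tracking_value M T (augmented_filtration M T B) B 0"
  shows "(\<lambda>\<kappa>. enn2real (v \<kappa>)) \<in> \<Theta>[at_right 0](\<lambda>\<kappa>. \<kappa> powr H)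
       \<and> (\<forall>\<kappa>. 0 < \<kappa> \<and> \<kappa> \<le> T\<^sup>2 / 2 \<longrightarrow>
            ennreal (\<kappa> powr H / 12 *
              (T * 2 powr H - 2 * H / (2 * H + 1) * 2 powr (H + 1 / 2) * sqrt \<kappa>)) \<le> v \<kappa>
          \<and> v \<kappa> \<le> ennreal (T * Gamma (2 * H + 1) * \<kappa> powr H))"
proof -
  have T: "0 < T" and H: "0 < H" "H < 1" using assms by auto
  have lower: "ennreal (\<kappa> powr H / 12 *
      (T * 2 powr H - 2 * H / (2 * H + 1) * 2 powr (H + 1 / 2) * sqrt \<kappa>)) \<le> v \<kappa>"
    and small: "sqrt (2 * \<kappa>) \<le> T" if "0 < \<kappa>" "\<kappa> \<le> T\<^sup>2 / 2" for \<kappa>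
  proof -
    show "sqrt (2 * \<kappa>) \<le> T"
      using T that by (intro real_le_lsqrt) auto
    then show "ennreal (\<kappa> powr H / 12 *
      (T * 2 powr H - 2 * H / (2 * H + 1) * 2 powr (H + 1 / 2) * sqrt \<kappa>)) \<le> v \<kappa>"
      unfolding v_def by (intro tracking_value_lower_bound assms H that)
  qed
  have upper: "v \<kappa> \<le> ennreal (T * Gamma (2 * H + 1) * \<kappa> powr H)" if "0 < \<kappa>" for \<kappa>
    unfolding v_def using T by (intro tracking_value_upper_bound assms H that) auto
  have G: "0 < Gamma (2 * H + 1)"
    using H by (intro Gamma_real_pos) auto
  have near: "\<forall>\<^sub>F \<kappa> in at_right 0. 0 < \<kappa> \<and> \<kappa> \<le> T\<^sup>2 / 2"
    using eventually_at_right_less[of "0::real"] eventually_at_right_real[of 0 "T\<^sup>2 / 2"] T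
    by (auto elim: eventually_elim2)
  have "(\<lambda>\<kappa>. enn2real (v \<kappa>)) \<in> O[at_right 0](\<lambda>\<kappa>. \<kappa> powr H)"
  proof (rule bigoI)
    show "\<forall>\<^sub>F \<kappa> in at_right 0. norm (enn2real (v \<kappa>)) \<le> T * Gamma (2 * H + 1) * norm (\<kappa> powr H)"
      using near
    proof eventually_elim
      case (elim \<kappa>)
      have "enn2real (v \<kappa>) \<le> enn2real (ennreal (T * Gamma (2 * H + 1) * \<kappa> powr H))"
        using elim by (intro enn2real_mono upper) auto
      then show ?case
        using T G by simp
    qed
  qed
  moreover have "(\<lambda>\<kappa>. enn2real (v \<kappa>)) \<in> \<Omega>[at_right 0](\<lambda>\<kappa>. \<kappa> powr H)"
  proof (rule landau_omega.bigI)
    \<comment> \<open>For \<open>\<kappa> \<le> T\<^sup>2 / 2\<close> the subtracted term is at most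
      the fraction \<open>2 * H / (2 * H + 1)\<close> of the leading term
      \<open>T * 2 powr H\<close>; the fraction \<open>1 / (2 * H + 1)\<close> survives.\<close>
    let ?c = "T * 2 powr H / (12 * (2 * H + 1))"
    show "0 < ?c"
      using T H by simp
    show "\<forall>\<^sub>F \<kappa> in at_right 0. norm (enn2real (v \<kappa>)) \<ge> ?c * norm (\<kappa> powr H)"
      using near
    proof eventually_elim
      case (elim \<kappa>)
      have "2 powr (H + 1 / 2) * sqrt \<kappa> = 2 powr H * sqrt (2 * \<kappa>)"
        by (simp add: powr_add powr_half_sqrt real_sqrt_mult)
      also have "\<dots> \<le> 2 powr H * T"
        using small elim by (intro mult_left_mono) auto
      finally have "2 * H / (2 * H + 1) * (2 powr (H + 1 / 2) * sqrt \<kappa>)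
          \<le> 2 * H / (2 * H + 1) * (2 powr H * T)"
        using H by (intro mult_left_mono) auto
      moreover have "2 powr H * T - 2 * H / (2 * H + 1) * (2 powr H * T) = T * 2 powr H / (2 * H + 1)"
        using H by (simp add: field_simps)
      ultimately have "T * 2 powr H / (2 * H + 1)
          \<le> T * 2 powr H - 2 * H / (2 * H + 1) * 2 powr (H + 1 / 2) * sqrt \<kappa>"
        by (simp add: mult.commute mult.left_commute)
      then have "\<kappa> powr H / 12 * (T * 2 powr H / (2 * H + 1)) \<le> \<kappa> powr H / 12 *
          (T * 2 powr H - 2 * H / (2 * H + 1) * 2 powr (H + 1 / 2) * sqrt \<kappa>)"
        by (intro mult_left_mono) auto
      then have "ennreal (\<kappa> powr H / 12 * (T * 2 powr H / (2 * H + 1))) \<le> v \<kappa>"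
        using lower[of \<kappa>] elim by (meson ennreal_leI order.trans)
      \<comment> \<open>\<open>enn2real\<close> sends infinity to 0, so the lower bound passes to
        the reals only for a finite value.\<close>
      moreover have "v \<kappa> < \<top>"
        using upper[of \<kappa>] elim ennreal_less_top order.strict_trans1 by blast
      ultimately have "enn2real (ennreal (\<kappa> powr H / 12 * (T * 2 powr H / (2 * H + 1)))) \<le> enn2real (v \<kappa>)"
        by (intro enn2real_mono)
      then show ?case
        using T H by (simp add: mult.commute)
    qed
  qed
  ultimately show ?thesis
    using lower upper by (auto simp: bigthetaI)
qed

end
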